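(* For all $(\xi,\eta)\in\Omega$, the functions $u,\bar u,v,\bar v,w_1,w_2,w_3,w_4$ defined in the context satisfy $$\partial_\eta u=-\bar v\,w_1,\qquad \partial_\eta v=\bar u\,w_1,\qquad \partial_\eta w_3=\bar u\,v,$$ $$\partial_\eta \bar u=v\,w_2,\qquad \partial_\eta \bar v=-u\,w_2,\qquad \partial_\eta w_4=-u\,\bar v .$$
   Context: The overbar does NOT denote complex conjugation; barred and unbarred quantities are independent. Fix $N\ge 1$ and complex constants $L_j,\bar L_j,\alpha_j,\bar\alpha_j,c_j,\bar c_j$ ($1\le j\le N$) with $L_j\ne0$, $\bar L_j\neq 0$ and $L_j\neq\bar L_k$ for all $j,k$. Put $\mathsf L=\mathrm{diag}(L_1,\dots,L_N)$, $\bar{\mathsf L}=\mathrm{diag}(\bar L_1,\dots,\bar L_N)$, columns $|\alpha\rangle=(\alpha_1,\dots,\alpha_N)^T$, $|\bar\alpha\rangle=(\bar\alpha_1,\dots,\bar\alpha_N)^T$, rows $\langle c|=(c_1,\dots,c_N)$, $\langle\bar c|=(\bar c_1,\dots,\bar c_N)$. For $(\xi,\eta)\in\mathbb C^2$ define the rows $$\langle a|=\langle c|\exp(\xi\mathsf L^{-1}-\eta\mathsf L),\qquad \langle\bar a|=\langle\bar c|\exp(-\xi\bar{\mathsf L}^{-1}+\eta\bar{\mathsf L}),$$ and the $N\times N$ matrices $$\mathsf A=\Big(\frac{\alpha_jc_k}{\bar L_j-L_k}\Big)_{j,k=1}^{N}\exp(\xi\mathsf L^{-1}-\eta\mathsf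 L),\qquad \bar{\mathsf A}=\Big(\frac{\bar\alpha_j\bar c_k}{L_j-\bar L_k}\Big)_{j,k=1}^{N}\exp(-\xi\bar{\mathsf L}^{-1}+\eta\bar{\mathsf L}),$$ which satisfy $\bar{\mathsf L}\mathsf A-\mathsf A\mathsf L=|\alpha\rangle\langle a|$ and $\mathsf L\bar{\mathsf A}-\bar{\mathsf A}\bar{\mathsf L}=|\bar\alpha\rangle\langle\bar a|$. Let $\Omega\subset\mathbb C^2$ be the open set where $\det(1+\mathsf A\bar{\mathsf A})\ne0$, and on $\Omega$ put $\mathsf G=(1+\mathsf A\bar{\mathsf A})^{-1}$, $\bar{\mathsf G}=(1+\bar{\mathsf A}\mathsf A)^{-1}$. Put $\langle b|=\langle a|\mathsf L^{-1}$, $\langle\bar b|=\langle\bar a|\bar{\mathsf L}^{-1}$, $|\beta\rangle=\bar{\mathsf L}^{-1}|\alpha\rangle$, $|\bar\beta\rangle=\mathsf L^{-1}|\bar\alpha\rangle$. Define the scalar functions on $\Omega$ $$u=1-\langle\bar a|\mathsf G\mathsf A|\bar\beta\rangle,\quad v=\langle\bar a|\mathsf G|\beta\rangle,\quad \bar u=1-\langle a|\bar{\mathsf G}\bar{\mathsf A}|\beta\rangle,\quad \bar v=\langle a|\bar{\mathsf G}|\bar\beta\rangle,$$ $$w_1=\langle\bar a|\mathsf G|\alpha\rangle,\quad w_2=\langle a|\bar{\mathsf G}|\bar\alpha\rangle,\quad w_3=\langle\bar b|\mathsf G|\beta\rangle,\quad w_4=\langle b|\bar{\mathsf G}|\bar\beta\rangle.$$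 $\partial_\xi,\partial_\eta$ are (holomorphic) partial derivatives. *)

theory Defs
  imports "HOL-Analysis.Analysis"
begin

text \<open>
  Rows and columns of length N are both vectors \<open>complex ^ 'n\<close> with \<open>N = CARD('n)\<close>:
  \<open>r v* M\<close> is row times matrix, \<open>M *v s\<close> is matrix times column, and \<open>scalar_product r s\<close>
  is the bilinear product row times column, without complex conjugation.
\<close>

definition diag :: "complex ^ 'n \<Rightarrow> complex ^ 'n ^ 'n"
  where "diag x = (\<chi> i j. if i = j then x $ i else 0)"

definition mscale :: "complex \<Rightarrow> complex ^ 'n ^ 'm \<Rightarrow> complex ^ 'n ^ 'm"  (infixr \<open>*\<^sub>M\<close> 75)
  where "z *\<^sub>M M = (\<chi> i j. z * M $ i $ j)"

text \<open>
  The matrix type is not an instance of \<^class>\<open>real_normed_algebra_1\<close>, so \<^const>\<open>exp\<close> is not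
  available on it.
\<close>

definition mexp :: "complex ^ 'n ^ 'n \<Rightarrow> complex ^ 'n ^ 'n"
  where "mexp M = (\<Sum>k. (1 / fact k) *\<^sub>R (((**) M ^^ k) (mat 1)))"

lemma mpow_diag: "((**) (diag x) ^^ k) (mat 1) = diag (\<chi> i. x $ i ^ k)"
proof (induction k)
  case 0
  show ?case by (simp add: diag_def mat_def vec_eq_iff)
next
  case (Suc k)
  then show ?case
    by (simp add: diag_def matrix_matrix_mult_def vec_eq_iff if_distrib if_distribR
        sum.delta cong: if_cong)
qed

lemma mexp_diag: "mexp (diag x) = diag (\<chi> i. exp (x $ i))"
proof -
  have "(\<lambda>k. (1 / fact k) *\<^sub>R diag (\<chi> i. x $ i ^ k)) sums diag (\<chi> i. exp (x $ i))"
    unfolding sums_def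
  proof (intro vec_tendstoI)
    fix i j
    have "(\<lambda>k. x $ i ^ k /\<^sub>R fact k) sums exp (x $ i)"
      by (rule exp_converges)
    then show "((\<lambda>n. (\<Sum>k<n. (1 / fact k) *\<^sub>R diag (\<chi> i. x $ i ^ k)) $ i $ j)
        \<longlongrightarrow> diag (\<chi> i. exp (x $ i)) $ i $ j) sequentially"
      by (cases "i = j") (simp_all add: diag_def sums_def sum_component inverse_eq_divide)
  qed
  then show ?thesis
    unfolding mexp_def mpow_diag by (simp add: sums_iff)
qed

text \<open>
  The suffix \<open>b\<close> stands for the overbar. It is not complex conjugation: the barred and
  unbarred constants are independent.
\<close>

record ('n::finite) soliton_data =
  ev :: "complex ^ 'n"
  evb :: "complex ^ 'n"
  alpha :: "complex ^ 'n"
  alphab :: "complex ^ 'n"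
  cc :: "complex ^ 'n"
  ccb :: "complex ^ 'n"

definition LL :: "'n::finite soliton_data \<Rightarrow> complex ^ 'n ^ 'n"
  where "LL D = diag (ev D)"

definition LLb :: "'n::finite soliton_data \<Rightarrow> complex ^ 'n ^ 'n"
  where "LLb D = diag (evb D)"

definition EE :: "'n::finite soliton_data \<Rightarrow> complex \<Rightarrow> complex \<Rightarrow> complex ^ 'n ^ 'n"
  where "EE D \<xi> \<eta> = mexp (\<xi> *\<^sub>M matrix_inv (LL D) - \<eta> *\<^sub>M LL D)"

definition EEb :: "'n::finite soliton_data \<Rightarrow> complex \<Rightarrow> complex \<Rightarrow> complex ^ 'n ^ 'n"
  where "EEb D \<xi> \<eta> = mexp (- (\<xi> *\<^sub>M matrix_inv (LLb D)) + \<eta> *\<^sub>M LLb D)"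

definition row_a :: "'n::finite soliton_data \<Rightarrow> complex \<Rightarrow> complex \<Rightarrow> complex ^ 'n"
  where "row_a D \<xi> \<eta> = cc D v* EE D \<xi> \<eta>"

definition row_ab :: "'n::finite soliton_data \<Rightarrow> complex \<Rightarrow> complex \<Rightarrow> complex ^ 'n"
  where "row_ab D \<xi> \<eta> = ccb D v* EEb D \<xi> \<eta>"

definition AA :: "'n::finite soliton_data \<Rightarrow> complex \<Rightarrow> complex \<Rightarrow> complex ^ 'n ^ 'n"
  where "AA D \<xi> \<eta> =
    (\<chi> j k. alpha D $ j * cc D $ k / (evb D $ j - ev D $ k)) ** EE D \<xi> \<eta>"

definition AAb :: "'n::finite soliton_data \<Rightarrow> complex \<Rightarrow> complex \<Rightarrow> complex ^ 'n ^ 'n"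
  where "AAb D \<xi> \<eta> =
    (\<chi> j k. alphab D $ j * ccb D $ k / (ev D $ j - evb D $ k)) ** EEb D \<xi> \<eta>"

definition Omega :: "'n::finite soliton_data \<Rightarrow> (complex \<times> complex) set"
  where "Omega D = {(\<xi>, \<eta>). det (mat 1 + AA D \<xi> \<eta> ** AAb D \<xi> \<eta>) \<noteq> 0}"

text \<open>
  The functions below are total; off \<^const>\<open>Omega\<close>, where the inverses do not exist, their
  values are arbitrary.
\<close>

definition GG :: "'n::finite soliton_data \<Rightarrow> complex \<Rightarrow> complex \<Rightarrow> complex ^ 'n ^ 'n"
  where "GG D \<xi> \<eta> = matrix_inv (mat 1 + AA D \<xi> \<eta> ** AAb D \<xi> \<eta>)"

definition GGb :: "'n::finite soliton_data \<Rightarrow> complex \<Rightarrow> complex \<Rightarrow> complex ^ 'n ^ 'n"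
  where "GGb D \<xi> \<eta> = matrix_inv (mat 1 + AAb D \<xi> \<eta> ** AA D \<xi> \<eta>)"

definition row_b :: "'n::finite soliton_data \<Rightarrow> complex \<Rightarrow> complex \<Rightarrow> complex ^ 'n"
  where "row_b D \<xi> \<eta> = row_a D \<xi> \<eta> v* matrix_inv (LL D)"

definition row_bb :: "'n::finite soliton_data \<Rightarrow> complex \<Rightarrow> complex \<Rightarrow> complex ^ 'n"
  where "row_bb D \<xi> \<eta> = row_ab D \<xi> \<eta> v* matrix_inv (LLb D)"

definition beta :: "'n::finite soliton_data \<Rightarrow> complex ^ 'n"
  where "beta D = matrix_inv (LLb D) *v alpha D"

definition betab :: "'n::finite soliton_data \<Rightarrow> complex ^ 'n"
  where "betab D = matrix_inv (LL D) *v alphab D"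

definition u_fun :: "'n::finite soliton_data \<Rightarrow> complex \<Rightarrow> complex \<Rightarrow> complex"
  where "u_fun D \<xi> \<eta> =
    1 - scalar_product (row_ab D \<xi> \<eta>) ((GG D \<xi> \<eta> ** AA D \<xi> \<eta>) *v betab D)"

definition v_fun :: "'n::finite soliton_data \<Rightarrow> complex \<Rightarrow> complex \<Rightarrow> complex"
  where "v_fun D \<xi> \<eta> = scalar_product (row_ab D \<xi> \<eta>) (GG D \<xi> \<eta> *v beta D)"

definition ub_fun :: "'n::finite soliton_data \<Rightarrow> complex \<Rightarrow> complex \<Rightarrow> complex"
  where "ub_fun D \<xi> \<eta> =
    1 - scalar_product (row_a D \<xi> \<eta>) ((GGb D \<xi> \<eta> ** AAb D \<xi> \<eta>) *v beta D)"

definition vb_fun :: "'n::finite soliton_data \<Rightarrow> complex \<Rightarrow> complex \<Rightarrow> complex"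
  where "vb_fun D \<xi> \<eta> = scalar_product (row_a D \<xi> \<eta>) (GGb D \<xi> \<eta> *v betab D)"

definition w1 :: "'n::finite soliton_data \<Rightarrow> complex \<Rightarrow> complex \<Rightarrow> complex"
  where "w1 D \<xi> \<eta> = scalar_product (row_ab D \<xi> \<eta>) (GG D \<xi> \<eta> *v alpha D)"

definition w2 :: "'n::finite soliton_data \<Rightarrow> complex \<Rightarrow> complex \<Rightarrow> complex"
  where "w2 D \<xi> \<eta> = scalar_product (row_a D \<xi> \<eta>) (GGb D \<xi> \<eta> *v alphab D)"

definition w3 :: "'n::finite soliton_data \<Rightarrow> complex \<Rightarrow> complex \<Rightarrow> complex"
  where "w3 D \<xi> \<eta> = scalar_product (row_bb D \<xi> \<eta>) (GG D \<xi> \<eta> *v beta D)"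

definition w4 :: "'n::finite soliton_data \<Rightarrow> complex \<Rightarrow> complex \<Rightarrow> complex"
  where "w4 D \<xi> \<eta> = scalar_product (row_b D \<xi> \<eta>) (GGb D \<xi> \<eta> *v betab D)"

end

theory Submission
  imports Defs
begin

text \<open>
  Write \<open>A'\<close> for the barred matrix. By the Sylvester equations the derivative of \<open>1 + A A'\<close> has
  rank one, hence so has that of its inverse \<open>G\<close>. The derivatives of \<open>u\<close> and \<open>v\<close> follow once \<open>G\<close>
  is commuted past the barred diagonal matrix \<open>M\<close>, which costs two more rank-one terms. For
  \<open>w\<^sub>3\<close> one needs in addition that, between the barred row and the column \<open>\<alpha>\<close>, the inverse of
  \<open>M\<close> can be moved from one side of \<open>G\<close> to the other. This holds because multiplying \<open>G\<close> by the
  diagonal matrices of this row and column gives a symmetric matrix, as the two Cauchy matrices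
  are negative transposes of each other. The other three identities are the same ones with barred
  and unbarred data swapped and \<open>\<eta>\<close> replaced by \<open>- \<eta>\<close>.
\<close>

section \<open>Bilinear products, rank-one matrices and diagonal matrices\<close>

lemma scalar_product_add_left: "scalar_product (x + y) z = scalar_product x z + scalar_product y z"
  and scalar_product_scale_left: "scalar_product (k *s x) z = k * scalar_product x z"
  for x y z :: "'a::comm_semiring_1 ^ 'n"
  by (simp_all add: scalar_product_def algebra_simps sum.distrib sum_distrib_left)

lemma scalar_product_diff_left: "scalar_product (x - y) z = scalar_product x z - scalar_product y z"
  for x y z :: "'a::comm_ring_1 ^ 'n"
  by (simp add: scalar_product_def algebra_simps sum_subtractf)

lemma scalar_product_mult: "scalar_product x (X *v y) = scalar_product (x v* X) y"
  for X :: "'a::comm_semiring_1 ^ 'n ^ 'm"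
proof -
  have "(\<Sum>i\<in>UNIV. \<Sum>j\<in>UNIV. x $ i * (X $ i $ j * y $ j))
      = (\<Sum>j\<in>UNIV. \<Sum>i\<in>UNIV. x $ i * (X $ i $ j * y $ j))"
    by (rule sum.swap)
  then show ?thesis
    by (simp add: scalar_product_def matrix_vector_mult_def vector_matrix_mult_def
        sum_distrib_left sum_distrib_right mult.assoc)
qed

definition outer :: "'a::times ^ 'm \<Rightarrow> 'a ^ 'n \<Rightarrow> 'a ^ 'n ^ 'm"
  where "outer x y = (\<chi> i j. x $ i * y $ j)"

lemma matrix_add_rdistrib: "(X + Y) ** Z = X ** Z + Y ** Z"
  by (simp add: matrix_matrix_mult_def vec_eq_iff algebra_simps sum.distrib)

lemma vector_matrix_outer: "z v* outer x y = scalar_product z x *s y"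
  for x :: "'a::comm_semiring_1 ^ 'm"
  by (simp add: outer_def vector_matrix_mult_def scalar_product_def vec_eq_iff sum_distrib_right
      mult.assoc)

lemma matrix_mult_outer: "X ** outer x y = outer (X *v x) y"
  for x :: "'a::comm_semiring_1 ^ 'm"
  by (simp add: outer_def matrix_matrix_mult_def matrix_vector_mult_def vec_eq_iff
      sum_distrib_right mult.assoc)

lemma outer_matrix_mult: "outer x y ** X = outer x (y v* X)"
  for x :: "'a::comm_semiring_1 ^ 'm"
  by (simp add: outer_def matrix_matrix_mult_def vector_matrix_mult_def vec_eq_iff
      sum_distrib_left mult.assoc)

lemma diag_mult_entry: "(diag x ** X) $ i $ j = x $ i * X $ i $ j"
  by (simp add: diag_def matrix_matrix_mult_def if_distrib if_distribR sum.delta cong: if_cong)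

lemma mult_diag_entry: "(X ** diag x) $ i $ j = X $ i $ j * x $ j"
  by (simp add: diag_def matrix_matrix_mult_def if_distrib if_distribR sum.delta' cong: if_cong)

lemma vector_mult_diag_entry: "(y v* diag x) $ j = y $ j * x $ j"
  by (simp add: diag_def vector_matrix_mult_def if_distrib if_distribR sum.delta' cong: if_cong)

lemma diag_mult_vector_entry: "(diag x *v y) $ j = x $ j * y $ j"
  by (simp add: diag_def matrix_vector_mult_def if_distrib if_distribR sum.delta cong: if_cong)

section \<open>Inverse matrices\<close>

lemma matrix_inv_works:
  fixes X :: "complex ^ 'n ^ 'n"
  assumes "det X \<noteq> 0"
  shows "X ** matrix_inv X = mat 1" and "matrix_inv X ** X = mat 1"
proof -
  have "\<exists>Y. X ** Y = mat 1 \<and> Y ** X = mat 1"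
    using assms by (simp add: invertible_det_nz flip: invertible_def)
  then have "X ** matrix_inv X = mat 1 \<and> matrix_inv X ** X = mat 1"
    unfolding matrix_inv_def by (rule someI_ex)
  then show "X ** matrix_inv X = mat 1" and "matrix_inv X ** X = mat 1"
    by auto
qed

lemma matrix_inv_eqI:
  fixes X :: "complex ^ 'n ^ 'n"
  assumes "X ** Y = mat 1"
  shows "matrix_inv X = Y"
proof -
  have "det X \<noteq> 0"
    by (metis assms det_I det_mul mult_zero_left zero_neq_one)
  then show ?thesis
    by (metis assms matrix_inv_works(2) matrix_mul_assoc matrix_mul_lid matrix_mul_rid)
qed

lemma matrix_inv_diag:
  assumes "\<And>j. x $ j \<noteq> 0"
  shows "matrix_inv (diag x) = diag (\<chi> j. 1 / x $ j)"
  using assms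
  by (intro matrix_inv_eqI) (auto simp: vec_eq_iff diag_mult_entry mat_def, auto simp: diag_def)

lemma vector_matrix_mscale: "z v* (k *\<^sub>M X) = k *s (z v* X)"
  by (simp add: vec_eq_iff vector_matrix_mult_def mscale_def sum_distrib_left mult_ac)

text \<open>Because \<open>Y (1 + X Y) = (1 + Y X) Y\<close>, multiplying \<open>Y G X\<close> by
  \<open>1 + Y X\<close> leaves just \<open>Y X\<close>.\<close>

lemma push_through_inverse:
  fixes X :: "complex ^ 'n ^ 'm"
  assumes "(mat 1 + X ** Y) ** G = mat 1"
  shows "(mat 1 + Y ** X) ** (mat 1 - Y ** G ** X) = mat 1"
proof -
  have "(mat 1 + Y ** X) ** (mat 1 - Y ** G ** X + Y ** G ** X)
      = mat 1 + Y ** ((mat 1 + X ** Y) ** G) ** X"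
    by (simp add: assms)
  also have "\<dots> = mat 1 + (mat 1 + Y ** X) ** (Y ** G ** X)"
    by (simp add: matrix_add_ldistrib matrix_add_rdistrib matrix_mul_assoc)
  finally show ?thesis
    unfolding matrix_add_ldistrib[of "mat 1 + Y ** X"] by (rule add_right_imp_eq)
qed

text \<open>The right inverse just found forces a nonzero determinant. This carries the condition
  defining \<open>Omega\<close> over to the copy of the argument in which barred and unbarred data
  are exchanged.\<close>

lemma det_one_plus_mult_swap:
  fixes X :: "complex ^ 'n ^ 'm"
  assumes "det (mat 1 + X ** Y) \<noteq> 0"
  shows "det (mat 1 + Y ** X) \<noteq> 0"
  using push_through_inverse[OF matrix_inv_works(1)[OF assms]]
  by (metis det_I det_mul mult_zero_left zero_neq_one)

section \<open>Entrywise complex derivatives\<close>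

definition vderiv :: "(complex \<Rightarrow> complex ^ 'n) \<Rightarrow> complex ^ 'n \<Rightarrow> complex \<Rightarrow> bool"
  where "vderiv f f' t \<longleftrightarrow> (\<forall>i. ((\<lambda>s. f s $ i) has_field_derivative f' $ i) (at t))"

text \<open>Entrywise, like \<open>vderiv\<close>: a Frechet derivative on the vector type would
  only be real linear, whereas holomorphic derivatives are wanted.\<close>

definition mderiv :: "(complex \<Rightarrow> complex ^ 'n ^ 'm) \<Rightarrow> complex ^ 'n ^ 'm \<Rightarrow> complex \<Rightarrow> bool"
  where "mderiv f f' t \<longleftrightarrow> (\<forall>i j. ((\<lambda>s. f s $ i $ j) has_field_derivative f' $ i $ j) (at t))"

lemma mderiv_mult:
  assumes "mderiv f f' t" and "mderiv g g' t"
  shows "mderiv (\<lambda>s. f s ** g s) (f' ** g t + f t ** g') t"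
  using assms unfolding mderiv_def matrix_matrix_mult_def
  by (auto simp: sum.distrib[symmetric] mult.commute intro!: derivative_eq_intros)

lemma vderiv_mult:
  assumes "vderiv f f' t" and "mderiv g g' t"
  shows "vderiv (\<lambda>s. f s v* g s) (f' v* g t + f t v* g') t"
  using assms unfolding mderiv_def vderiv_def vector_matrix_mult_def
  by (auto simp: sum.distrib[symmetric] mult.commute intro!: derivative_eq_intros)

lemma has_field_derivative_scalar_product:
  assumes "vderiv f f' t"
  shows "((\<lambda>s. scalar_product (f s) y) has_field_derivative scalar_product f' y) (at t)"
  using assms unfolding vderiv_def scalar_product_def
  by (auto intro!: derivative_eq_intros)

lemma field_differentiable_prod:
  assumes "\<And>i. i \<in> I \<Longrightarrow> f i field_differentiable (at t)"
  shows "(\<lambda>s. \<Prod>i\<in>I. f i s) field_differentiable (at t)"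
  using assms
  by (induction I rule: infinite_finite_induct) (auto intro!: derivative_intros)

lemma field_differentiable_det:
  fixes f :: "complex \<Rightarrow> complex ^ 'n ^ 'n"
  assumes "\<And>i j. (\<lambda>s. f s $ i $ j) field_differentiable (at t)"
  shows "(\<lambda>s. det (f s)) field_differentiable (at t)"
  unfolding det_def using assms
  by (intro field_differentiable_sum field_differentiable_mult field_differentiable_prod
      field_differentiable_const)

text \<open>Cramer's rule for the \<open>l\<close>-th unit vector. It shows each entry of the
  inverse as a quotient of determinants, which makes differentiability visible.\<close>

lemma matrix_inv_entry:
  fixes X :: "complex ^ 'n ^ 'n"
  assumes "det X \<noteq> 0"
  shows "matrix_inv X $ k $ l
    = det (\<chi> i j. if j = k then mat 1 $ i $ l else X $ i $ j) / det X"
proof -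
  have "X *v (\<chi> i. matrix_inv X $ i $ l) = (\<chi> i. mat 1 $ i $ l)"
    using matrix_inv_works(1)[OF assms]
    by (simp add: vec_eq_iff matrix_matrix_mult_def matrix_vector_mult_def)
  then show ?thesis
    by (subst (asm) cramer[OF assms]) (simp add: vec_eq_iff cong: if_cong)
qed

text \<open>Cramer's rule yields the existence of the derivative; its value then comes from
  differentiating the identity \<open>f s ** matrix_inv (f s) = mat 1\<close>, valid near
  \<open>t\<close>.\<close>

lemma mderiv_matrix_inv:
  fixes f :: "complex \<Rightarrow> complex ^ 'n ^ 'n"
  assumes f: "mderiv f f' t" and nz: "det (f t) \<noteq> 0"
  shows "mderiv (\<lambda>s. matrix_inv (f s)) (- (matrix_inv (f t) ** f' ** matrix_inv (f t))) t"
proof -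
  have entry: "(\<lambda>s. f s $ i $ j) field_differentiable (at t)" for i j
    using f unfolding mderiv_def field_differentiable_def by blast
  have det: "(\<lambda>s. det (f s)) field_differentiable (at t)"
    by (rule field_differentiable_det[OF entry])
  then have "isCont (\<lambda>s. det (f s)) t"
    by (rule field_differentiable_imp_continuous_at)
  then have "((\<lambda>s. det (f s)) \<longlongrightarrow> det (f t)) (nhds t)"
    by (simp add: continuous_at tendsto_nhds_iff)
  \<comment> \<open>The filter \<open>nhds t\<close> includes \<open>t\<close> itself, as
    \<open>DERIV_cong_ev\<close> demands.\<close>
  then have ev: "\<forall>\<^sub>F s in nhds t. det (f s) \<noteq> 0"
    by (rule tendsto_imp_eventually_ne) (rule nz)
  define g where "g s = matrix_inv (f s)" for s
  have "(\<lambda>s. g s $ k $ l) field_differentiable (at t)" for k l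
  proof -
    define F where "F s = (\<chi> i j. if j = k then mat 1 $ i $ l else f s $ i $ j)" for s
    define h where "h s = det (F s) / det (f s)" for s
    have "(\<lambda>s. F s $ i $ j) field_differentiable (at t)" for i j
      using entry[of i j] by (cases "j = k") (simp_all add: F_def)
    then have "h field_differentiable (at t)"
      unfolding h_def by (intro field_differentiable_divide[OF _ det nz] field_differentiable_det)
    moreover have "\<forall>\<^sub>F s in nhds t. g s $ k $ l = h s"
      using ev by eventually_elim (simp add: g_def h_def F_def matrix_inv_entry)
    ultimately show ?thesis
      unfolding field_differentiable_def by (subst DERIV_cong_ev[OF refl _ refl])
  qed
  then obtain d where d: "((\<lambda>s. g s $ k $ l) has_field_derivative d k l) (at t)" for k l
    unfolding field_differentiable_def by metis
  define g' where "g' = (\<chi> k l. d k l)"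
  have g: "mderiv g g' t"
    using d by (simp add: mderiv_def g'_def)
  have "f' ** g t + f t ** g' = 0"
  proof -
    have "(f' ** g t + f t ** g') $ i $ j = 0" for i j
    proof (rule DERIV_unique)
      show "((\<lambda>s. (f s ** g s) $ i $ j) has_field_derivative (f' ** g t + f t ** g') $ i $ j) (at t)"
        using mderiv_mult[OF f g] by (simp add: mderiv_def)
      have "\<forall>\<^sub>F s in nhds t. (f s ** g s) $ i $ j = mat 1 $ i $ j"
        using ev by eventually_elim (simp add: g_def matrix_inv_works)
      then show "((\<lambda>s. (f s ** g s) $ i $ j) has_field_derivative 0) (at t)"
        by (subst DERIV_cong_ev) auto
    qed
    then show ?thesis
      by (simp add: vec_eq_iff)
  qed
  then have "g t ** (f' ** g t) + g t ** (f t ** g') = 0"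
    by (metis matrix_add_ldistrib matrix_mul_assoc matrix_vector_mult_0_right mult.right_neutral
        add.right_neutral add_left_cancel)
  then have "g t ** f' ** g t + g' = 0"
    using nz by (simp add: matrix_mul_assoc g_def matrix_inv_works)
  then have "g' = - (g t ** f' ** g t)"
    by (simp add: eq_neg_iff_add_eq_0 add.commute)
  with g show ?thesis
    unfolding g_def by simp
qed


section \<open>Symmetry of an inverse between diagonal factors\<close>

lemma symmetric_dressing:
  fixes K :: "complex ^ 'n ^ 'n"
  assumes K: "transpose K = K"
    and right: "(mat 1 + diag a ** K ** diag p) ** G = mat 1"
    and left: "G ** (mat 1 + diag a ** K ** diag p) = mat 1"
  shows "transpose (diag p ** G ** diag a) = diag p ** G ** diag a"
proof -
  \<comment> \<open>If both diagonals were invertible, \<open>H\<close> would be the inverse of the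
    symmetric matrix \<open>E^-1 + K\<close>. As they may have zeros, \<open>H\<close> and its
    transpose are instead both shown to solve \<open>W ** X = E\<close>, from the right and the left
    inverse equation respectively, and \<open>W\<close> is shown to be invertible.\<close>
  define H where "H = diag p ** G ** diag a"
  define E where "E = diag p ** diag a"
  define W where "W = mat 1 + E ** K"
  have tdiag: "transpose (diag x) = diag x" for x :: "complex ^ 'n"
    by (simp add: transpose_def diag_def vec_eq_iff)
  have comm: "diag a ** diag p = E"
    by (simp add: E_def vec_eq_iff diag_mult_entry) (simp add: diag_def mult.commute)
  have tE: "transpose E = E"
    using comm by (simp add: E_def matrix_transpose_mul tdiag)
  have "diag p ** ((mat 1 + diag a ** K ** diag p) ** G) ** diag a = E"
    by (simp add: right E_def)
  then have "W ** H = E"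
    by (simp add: W_def H_def E_def matrix_add_ldistrib matrix_add_rdistrib matrix_mul_assoc)
  have "diag p ** (G ** (mat 1 + diag a ** K ** diag p)) ** diag a = E"
    by (simp add: left E_def)
  then have "H + H ** K ** E = E"
    by (simp add: H_def E_def matrix_add_ldistrib matrix_add_rdistrib matrix_mul_assoc)
  then have "transpose (H + H ** K ** E) = E"
    by (simp add: tE)
  moreover have "transpose (X + Y) = transpose X + transpose Y" for X Y :: "complex ^ 'n ^ 'n"
    by (simp add: transpose_def vec_eq_iff)
  ultimately have "W ** transpose H = E"
    by (simp add: W_def matrix_transpose_mul tE K matrix_add_rdistrib matrix_mul_assoc)
  \<comment> \<open>The inverse of \<open>W = 1 + E K\<close>: by \<open>W H = E\<close>, the
    product \<open>W (1 - H K)\<close> is \<open>W - E K = 1\<close>.\<close>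
  define V where "V = mat 1 - H ** K"
  have "W ** (V + H ** K) = W"
    by (simp add: V_def)
  then have "W ** V + E ** K = W"
    by (simp add: matrix_add_ldistrib matrix_mul_assoc \<open>W ** H = E\<close>)
  then have "W ** V = mat 1"
    by (simp add: W_def)
  then have "V ** W = mat 1"
    by (rule matrix_left_right_inverse1)
  then have "H = V ** E" and "transpose H = V ** E"
    using \<open>W ** H = E\<close> \<open>W ** transpose H = E\<close> by (metis matrix_mul_assoc matrix_mul_lid)+
  then show ?thesis
    unfolding H_def by simp
qed

section \<open>Weighted Cauchy matrices and their Sylvester equation\<close>

definition cauchy ::
    "complex ^ 'n \<Rightarrow> complex ^ 'n \<Rightarrow> complex ^ 'm \<Rightarrow> complex ^ 'm \<Rightarrow> complex ^ 'm ^ 'n"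
  where "cauchy a x c y = (\<chi> j k. a $ j * c $ k / (x $ j - y $ k))"

lemma cauchy_sylvester:
  assumes "\<And>j k. x $ j \<noteq> y $ k"
  shows "diag x ** cauchy a x c y = cauchy a x c y ** diag y + outer a c"
  using assms
  by (auto simp: vec_eq_iff diag_mult_entry mult_diag_entry cauchy_def outer_def field_simps)

text \<open>The matrix is linear in its column weight. The exponentials are later absorbed into this
  weight, so that \<open>AA\<close> and \<open>AAb\<close> depend on \<eta> through it
  alone.\<close>

lemma mderiv_cauchy:
  assumes "vderiv c c' t" and "\<And>j k. x $ j \<noteq> y $ k"
  shows "mderiv (\<lambda>s. cauchy a x (c s) y) (cauchy a x c' y) t"
  using assms unfolding mderiv_def vderiv_def cauchy_def
  by (auto intro!: derivative_eq_intros)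

text \<open>
  The sign \<open>s\<close> is \<open>1\<close> when \<open>p\<close> is the barred row and \<open>- 1\<close> when the roles of the barred and
  unbarred data are exchanged.
\<close>

locale cauchy_pair =
  fixes s t :: complex and l m a g :: "complex ^ 'n" and p q :: "complex \<Rightarrow> complex ^ 'n"
  assumes m_nz: "\<And>j. m $ j \<noteq> 0"
    and m_neq_l: "\<And>j k. m $ j \<noteq> l $ k"
    and p_deriv: "vderiv p (s *s (p t v* diag m)) t"
    and q_deriv: "vderiv q (- s *s (q t v* diag l)) t"
    and det_nz: "det (mat 1 + cauchy a m (q t) l ** cauchy g l (p t) m) \<noteq> 0"
begin

definition A where "A r = cauchy a m (q r) l"
definition B where "B r = cauchy g l (p r) m"
definition G where "G r = matrix_inv (mat 1 + A r ** B r)"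
definition Gb where "Gb r = matrix_inv (mat 1 + B r ** A r)"
definition b where "b = matrix_inv (diag m) *v a"
definition d where "d = matrix_inv (diag l) *v g"
definition v where "v r = scalar_product (p r) (G r *v b)"
definition w where "w r = scalar_product (p r) (G r *v a)"
definition ub where "ub r = 1 - scalar_product (q r) ((Gb r ** B r) *v b)"

section \<open>The two inverses and their commutation with the diagonal matrices\<close>

lemma G_right: "(mat 1 + A t ** B t) ** G t = mat 1"
  and G_left: "G t ** (mat 1 + A t ** B t) = mat 1"
  using det_nz by (simp_all add: G_def A_def B_def matrix_inv_works)

lemma Gb_eq: "Gb t + B t ** G t ** A t = mat 1"
proof -
  have "Gb t = mat 1 - B t ** G t ** A t"
    unfolding Gb_def by (intro matrix_inv_eqI push_through_inverse G_right)
  then show ?thesis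
    by simp
qed

text \<open>Multiply \<open>Gb_eq\<close> by \<open>B\<close> on the right and compare with
  \<open>B G (1 + A B) = B\<close>; the common term \<open>B G A B\<close> cancels.\<close>

lemma Gb_B: "Gb t ** B t = B t ** G t"
proof -
  have "(Gb t + B t ** G t ** A t) ** B t = B t ** (G t ** (mat 1 + A t ** B t))"
    by (simp add: Gb_eq G_left)
  then show ?thesis
    by (simp add: matrix_add_ldistrib matrix_add_rdistrib matrix_mul_assoc)
qed

lemma diag_m_b: "diag m *v b = a"
  using m_nz by (simp add: b_def matrix_inv_diag vec_eq_iff diag_mult_vector_entry)

lemma sylvester_A: "diag m ** A t = A t ** diag l + outer a (q t)"
  and sylvester_B: "diag l ** B t = B t ** diag m + outer g (p t)"
  unfolding A_def B_def using m_neq_l by (metis cauchy_sylvester)+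

text \<open>The matrix \<open>diag m\<close> passes through \<open>A\<close> as
  \<open>diag l\<close> and emerges from \<open>B\<close> as \<open>diag m\<close> again; each
  passage leaves a rank-one term.\<close>

lemma sylvester_AB:
  "diag m ** (A t ** B t)
    = A t ** B t ** diag m + outer a (q t v* B t) + outer (A t *v g) (p t)"
proof -
  have "diag m ** (A t ** B t) = A t ** (diag l ** B t) + outer a (q t v* B t)"
    by (simp add: matrix_mul_assoc sylvester_A matrix_add_rdistrib outer_matrix_mult)
  then show ?thesis
    by (simp add: sylvester_B matrix_add_ldistrib matrix_mult_outer matrix_mul_assoc)
qed

text \<open>This is \<open>sylvester_AB\<close> with \<open>G\<close> multiplied on both
  sides.\<close>

lemma sylvester_G:
  "G t ** diag m = diag m ** G t + outer (G t *v a) (q t v* B t v* G t)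
    + outer (G t *v (A t *v g)) (p t v* G t)"
proof -
  have "G t ** diag m = G t ** (diag m ** (mat 1 + A t ** B t)) ** G t"
    by (simp add: G_right flip: matrix_mul_assoc)
  also have "diag m ** (mat 1 + A t ** B t)
      = (mat 1 + A t ** B t) ** diag m + outer a (q t v* B t) + outer (A t *v g) (p t)"
    by (simp add: matrix_add_ldistrib matrix_add_rdistrib sylvester_AB)
  also have "G t ** \<dots> ** G t = (G t ** (mat 1 + A t ** B t)) ** diag m ** G t
      + outer (G t *v a) (q t v* B t v* G t) + outer (G t *v (A t *v g)) (p t v* G t)"
    by (simp only: matrix_add_ldistrib[of "G t"] matrix_add_rdistrib[of _ _ "G t"] matrix_mult_outer
        outer_matrix_mult matrix_mul_assoc)
  finally show ?thesis
    by (simp add: G_left)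
qed

lemma row_diag_m:
  "x v* G t v* diag m = x v* diag m v* G t
    + scalar_product (x v* G t) a *s (q t v* B t v* G t)
    + scalar_product (x v* G t) (A t *v g) *s (p t v* G t)"
  by (simp add: vector_matrix_mul_assoc[of x] sylvester_G vector_matrix_mult_add_rdistrib
      vector_matrix_outer scalar_product_mult)

section \<open>Derivatives of the matrices and of the scalar functions\<close>

lemma A_deriv: "mderiv A (- s *\<^sub>M (A t ** diag l)) t"
  and B_deriv: "mderiv B (s *\<^sub>M (B t ** diag m)) t"
proof -
  have cauchy_scale: "cauchy x y (k *s (z v* diag c)) c = k *\<^sub>M (cauchy x y z c ** diag c)"
    for x y c z :: "complex ^ 'n" and k
    by (simp add: vec_eq_iff cauchy_def mscale_def mult_diag_entry vector_mult_diag_entry)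
  show "mderiv A (- s *\<^sub>M (A t ** diag l)) t"
    unfolding A_def cauchy_scale[symmetric] by (rule mderiv_cauchy[OF q_deriv m_neq_l])
  show "mderiv B (s *\<^sub>M (B t ** diag m)) t"
    unfolding B_def cauchy_scale[symmetric]
    by (rule mderiv_cauchy[OF p_deriv]) (metis m_neq_l)
qed

text \<open>The product rule gives \<open>- s A (L B - B M)\<close> for the derivative of
  \<open>A B\<close>, with \<open>L = diag l\<close> and \<open>M = diag m\<close>. By
  \<open>sylvester_B\<close> the bracket is the outer product of \<open>g\<close> and
  \<open>p t\<close>.\<close>

lemma G_deriv: "mderiv G (s *\<^sub>M outer (G t *v (A t *v g)) (p t v* G t)) t"
proof -
  from A_deriv B_deriv have "mderiv (\<lambda>r. A r ** B r)
      (- s *\<^sub>M (A t ** diag l) ** B t + A t ** (s *\<^sub>M (B t ** diag m))) t"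
    by (rule mderiv_mult)
  also have "- s *\<^sub>M (A t ** diag l) ** B t + A t ** (s *\<^sub>M (B t ** diag m))
      = - s *\<^sub>M outer (A t *v g) (p t)"
  proof -
    have "- s *\<^sub>M (A t ** diag l) ** B t + A t ** (s *\<^sub>M (B t ** diag m))
        = - s *\<^sub>M (A t ** (diag l ** B t)) + s *\<^sub>M (A t ** (B t ** diag m))"
      unfolding matrix_mul_assoc[of "A t" "diag l"]
      by (simp add: vec_eq_iff mscale_def matrix_matrix_mult_def sum_distrib_left mult_ac
          flip: sum_negf)
    then show ?thesis
      by (simp add: sylvester_B matrix_add_ldistrib matrix_mult_outer)
        (simp add: vec_eq_iff mscale_def algebra_simps)
  qed
  finally have "mderiv (\<lambda>r. mat 1 + A r ** B r) (- s *\<^sub>M outer (A t *v g) (p t)) t"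
    unfolding mderiv_def by (auto intro!: derivative_eq_intros)
  moreover have "det (mat 1 + A t ** B t) \<noteq> 0"
    using det_nz by (simp add: A_def B_def)
  ultimately have "mderiv G (- (G t ** (- s *\<^sub>M outer (A t *v g) (p t)) ** G t)) t"
    unfolding G_def by (rule mderiv_matrix_inv)
  also have "- (G t ** (- s *\<^sub>M outer (A t *v g) (p t)) ** G t)
      = s *\<^sub>M (G t ** outer (A t *v g) (p t) ** G t)"
    by (simp add: vec_eq_iff mscale_def matrix_matrix_mult_def sum_distrib_left sum_distrib_right
        mult_ac flip: sum_negf)
  finally show ?thesis
    by (simp add: matrix_mult_outer outer_matrix_mult)
qed

lemma row_G_deriv:
  assumes "vderiv x x' t"
  shows "vderiv (\<lambda>r. x r v* G r)
    (x' v* G t + (s * scalar_product (x t v* G t) (A t *v g)) *s (p t v* G t)) t"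
proof -
  show ?thesis
    using vderiv_mult[OF assms G_deriv]
    by (simp add: vector_matrix_mscale vector_matrix_outer scalar_product_mult vector_smult_assoc)
qed

text \<open>The contribution of the derivative of \<open>G\<close> is exactly cancelled by the last
  rank-one term of \<open>row_diag_m\<close>.\<close>

lemma row_p_deriv:
  "vderiv (\<lambda>r. p r v* G r) (s *s (p t v* G t v* diag m) - (s * w t) *s (q t v* B t v* G t)) t"
proof -
  have "s *s (p t v* diag m) v* G t
      + (s * scalar_product (p t v* G t) (A t *v g)) *s (p t v* G t)
    = s *s (p t v* G t v* diag m) - (s * w t) *s (q t v* B t v* G t)"
    by (simp add: row_diag_m w_def scalar_product_mult scalar_vector_matrix_assoc
        vector_add_ldistrib vector_smult_assoc)
  then show ?thesis
    using row_G_deriv[OF p_deriv] by simp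
qed

lemma ub_eq: "ub t = 1 - scalar_product (q t v* B t v* G t) b"
  by (simp add: ub_def Gb_B scalar_product_mult vector_matrix_mul_assoc)

text \<open>Pair \<open>row_p_deriv\<close> with \<open>b\<close>. Since \<open>diag m\<close> maps
  \<open>b\<close> to \<open>a\<close>, the first term becomes \<open>s * w t\<close>, and the
  second supplies the remaining part of \<open>ub t\<close>.\<close>

lemma v_deriv: "(v has_field_derivative s * (ub t * w t)) (at t)"
proof -
  have "scalar_product (s *s (p t v* G t v* diag m) - (s * w t) *s (q t v* B t v* G t)) b
      = s * (ub t * w t)"
    by (simp add: scalar_product_diff_left scalar_product_scale_left ub_eq diag_m_b w_def
        algebra_simps flip: scalar_product_mult[of _ "diag m"])
      (simp add: scalar_product_mult)
  then show ?thesis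
    using has_field_derivative_scalar_product[OF row_p_deriv, of b]
    unfolding v_def scalar_product_mult by simp
qed

text \<open>The further factor \<open>A\<close> is differentiated too. By \<open>sylvester_A\<close>
  its derivative cancels all but \<open>s * w t\<close> times \<open>q t\<close> from the first term
  of \<open>row_p_deriv\<close>; with the second term, \<open>Gb_eq\<close> turns this into a
  multiple of \<open>q t v* Gb t\<close>. Pairing that row with \<open>d\<close> gives the function
  \<open>v\<close> of the copy with exchanged roles.\<close>

lemma u_deriv:
  "((\<lambda>r. 1 - scalar_product (p r) ((G r ** A r) *v d)) has_field_derivative
    - (s * (scalar_product (q t) (Gb t *v d) * w t))) (at t)"
proof -
  define r where "r = p t v* G t"
  have AL: "r v* diag m v* A t = r v* A t v* diag l + w t *s q t"
    by (simp add: vector_matrix_mul_assoc[of r] sylvester_A vector_matrix_mult_add_rdistrib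
        vector_matrix_outer)
      (simp add: r_def w_def scalar_product_mult)
  have "q t v* Gb t + q t v* B t v* G t v* A t = q t"
    by (simp add: vector_matrix_mul_assoc matrix_mul_assoc Gb_eq
        flip: vector_matrix_mult_add_rdistrib)
  then have q: "q t v* B t v* G t v* A t = q t - q t v* Gb t"
    by (simp add: eq_diff_eq add.commute)
  have "(s *s (r v* diag m) - (s * w t) *s (q t v* B t v* G t)) v* A t
      + r v* (- s *\<^sub>M (A t ** diag l)) = (s * w t) *s (q t v* Gb t)"
    by (simp add: vector_matrix_mult_diff_distrib scalar_vector_matrix_assoc AL q
        vector_matrix_mscale flip: vector_matrix_mul_assoc)
  then have "vderiv (\<lambda>r. p r v* G r v* A r) ((s * w t) *s (q t v* Gb t)) t"
    using vderiv_mult[OF row_p_deriv A_deriv] by (simp add: r_def)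
  from has_field_derivative_scalar_product[OF this, of d]
  show ?thesis
    by (auto simp: scalar_product_mult vector_matrix_mul_assoc scalar_product_scale_left mult_ac
        intro!: derivative_eq_intros)
qed

text \<open>Both sides are sums of the entries of one symmetric matrix \<open>H\<close>, divided by
  \<open>m\<close> at the row index on the left and at the column index on the right.\<close>

lemma swap_inv_m:
  "scalar_product (p t v* matrix_inv (diag m) v* G t) a = v t"
proof -
  define H where "H = diag (p t) ** G t ** diag a"
  \<comment> \<open>Strip the outer weights \<open>a\<close> and \<open>p t\<close> from
    \<open>A t ** B t\<close>. The entry of \<open>K\<close> at \<open>i\<close>, \<open>j\<close>
    is the sum over \<open>k\<close> of \<open>q_k g_k / ((m_i - l_k) (l_k - m_j))\<close>, which is
    symmetric in \<open>i\<close> and \<open>j\<close>.\<close>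
  define K where "K = cauchy (\<chi> _. 1) m (q t) l ** cauchy g l (\<chi> _. 1) m"
  have "transpose K = K"
    by (simp add: K_def transpose_def vec_eq_iff matrix_matrix_mult_def cauchy_def)
      (auto intro!: sum.cong simp: m_neq_l m_neq_l[symmetric] field_simps)
  moreover have "A t = diag a ** cauchy (\<chi> _. 1) m (q t) l"
    and "B t = cauchy g l (\<chi> _. 1) m ** diag (p t)"
    by (simp_all add: vec_eq_iff mult_diag_entry diag_mult_entry A_def B_def cauchy_def)
  then have "A t ** B t = diag a ** K ** diag (p t)"
    by (simp add: K_def matrix_mul_assoc)
  ultimately have "transpose H = H"
    unfolding H_def using G_left G_right by (intro symmetric_dressing) simp_all
  then have sym: "H $ i $ j = H $ j $ i" for i j
    by (simp add: transpose_def vec_eq_iff)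
  have H: "H $ i $ j = p t $ i * G t $ i $ j * a $ j" for i j
    by (simp add: H_def diag_mult_entry mult_diag_entry)
  have "scalar_product (p t v* matrix_inv (diag m) v* G t) a
      = (\<Sum>j\<in>UNIV. \<Sum>i\<in>UNIV. H $ i $ j / m $ i)"
    using m_nz
    by (simp add: scalar_product_def vector_matrix_mult_def[of _ "G t"] matrix_inv_diag
        vector_mult_diag_entry sum_distrib_right H)
  also have "\<dots> = (\<Sum>j\<in>UNIV. \<Sum>i\<in>UNIV. H $ j $ i / m $ i)"
    by (simp add: sym)
  also have "\<dots> = v t"
    using m_nz
    by (simp add: v_def scalar_product_def matrix_vector_mult_def[of "G t"] b_def matrix_inv_diag
        diag_mult_vector_entry sum_distrib_left H mult.assoc)
  finally show ?thesis .
qed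

text \<open>Dividing \<open>p\<close> by \<open>m\<close> removes the factor \<open>m\<close> from
  its derivative, so differentiation yields \<open>s * (v t + c * v t)\<close>. The value of
  \<open>c * v t\<close> is found by evaluating \<open>y v* diag m\<close> on \<open>b\<close> in
  two ways.\<close>

lemma w3_deriv:
  "((\<lambda>r. scalar_product (p r v* matrix_inv (diag m)) (G r *v b)) has_field_derivative
    s * (ub t * v t)) (at t)"
proof -
  define x where "x r = p r v* matrix_inv (diag m)" for r
  define y where "y = x t v* G t"
  define c where "c = scalar_product y (A t *v g)"
  have x: "x r = (\<chi> j. p r $ j / m $ j)" for r
    using m_nz by (simp add: x_def matrix_inv_diag vec_eq_iff vector_mult_diag_entry)
  have xm: "x t v* diag m = p t"
    using m_nz by (simp add: x vec_eq_iff vector_mult_diag_entry)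
  have "vderiv x (s *s p t) t"
    using p_deriv m_nz unfolding vderiv_def x
    by (auto simp: vector_mult_diag_entry intro!: derivative_eq_intros)
  from has_field_derivative_scalar_product[OF row_G_deriv[OF this], of b]
  have "((\<lambda>r. scalar_product (x r) (G r *v b)) has_field_derivative s * (v t + c * v t)) (at t)"
    by (simp add: scalar_product_mult scalar_product_add_left scalar_product_scale_left
        scalar_vector_matrix_assoc v_def c_def y_def algebra_simps)
  moreover have "v t + c * v t = ub t * v t"
  proof -
    have ya: "scalar_product y a = v t"
      using swap_inv_m by (simp add: y_def x_def)
    \<comment> \<open>First evaluation: \<open>diag m\<close> acts on \<open>b\<close> and gives
      \<open>a\<close>, and \<open>swap_inv_m\<close> applies. The second, below, moves
      \<open>diag m\<close> to the left through \<open>G\<close> by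
      \<open>row_diag_m\<close>.\<close>
    have "v t = scalar_product (y v* diag m) b"
      by (simp add: diag_m_b ya flip: scalar_product_mult)
    also have "\<dots> = v t + v t * scalar_product (q t v* B t v* G t) b + c * v t"
      unfolding y_def row_diag_m xm
      by (simp add: scalar_product_add_left scalar_product_scale_left ya[unfolded y_def])
        (simp add: v_def c_def y_def scalar_product_mult)
    finally show ?thesis
      by (simp add: ub_eq algebra_simps)
  qed
  ultimately show ?thesis
    by (simp add: x_def)
qed

end

section \<open>Specialization to the soliton data\<close>

lemma EE_eq:
  assumes "\<And>j. ev D $ j \<noteq> 0"
  shows "EE D \<xi> \<eta> = diag (\<chi> j. exp (\<xi> / ev D $ j - \<eta> * ev D $ j))"
proof -
  have "\<xi> *\<^sub>M matrix_inv (LL D) - \<eta> *\<^sub>M LL D = diag (\<chi> j. \<xi> / ev D $ j - \<eta> * ev D $ j)"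
    by (simp add: LL_def matrix_inv_diag assms) (simp add: vec_eq_iff mscale_def diag_def)
  then show ?thesis
    by (simp add: EE_def mexp_diag)
qed

lemma EEb_eq:
  assumes "\<And>j. evb D $ j \<noteq> 0"
  shows "EEb D \<xi> \<eta> = diag (\<chi> j. exp (- (\<xi> / evb D $ j) + \<eta> * evb D $ j))"
proof -
  have "- (\<xi> *\<^sub>M matrix_inv (LLb D)) + \<eta> *\<^sub>M LLb D
      = diag (\<chi> j. - (\<xi> / evb D $ j) + \<eta> * evb D $ j)"
    by (simp add: LLb_def matrix_inv_diag assms) (simp add: vec_eq_iff mscale_def diag_def)
  then show ?thesis
    by (simp add: EEb_def mexp_diag)
qed

theorem proposition2p2:
  fixes D :: "'n::finite soliton_data" and \<xi> \<eta> :: complex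
  assumes "\<And>j. ev D $ j \<noteq> 0"
    and "\<And>j. evb D $ j \<noteq> 0"
    and "\<And>j k. ev D $ j \<noteq> evb D $ k"
    and "(\<xi>, \<eta>) \<in> Omega D"
  shows "((\<lambda>t. u_fun D \<xi> t) has_field_derivative - (vb_fun D \<xi> \<eta> * w1 D \<xi> \<eta>)) (at \<eta>)
    \<and> ((\<lambda>t. v_fun D \<xi> t) has_field_derivative ub_fun D \<xi> \<eta> * w1 D \<xi> \<eta>) (at \<eta>)
    \<and> ((\<lambda>t. w3 D \<xi> t) has_field_derivative ub_fun D \<xi> \<eta> * v_fun D \<xi> \<eta>) (at \<eta>)
    \<and> ((\<lambda>t. ub_fun D \<xi> t) has_field_derivative v_fun D \<xi> \<eta> * w2 D \<xi> \<eta>) (at \<eta>)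
    \<and> ((\<lambda>t. vb_fun D \<xi> t) has_field_derivative - (u_fun D \<xi> \<eta> * w2 D \<xi> \<eta>)) (at \<eta>)
    \<and> ((\<lambda>t. w4 D \<xi> t) has_field_derivative - (u_fun D \<xi> \<eta> * vb_fun D \<xi> \<eta>)) (at \<eta>)"
proof -
  \<comment> \<open>Right multiplication by the diagonal exponential only rescales columns, so it
    turns the constant weights into \<open>row_a\<close> and \<open>row_ab\<close>.\<close>
  have A: "AA D \<xi> r = cauchy (alpha D) (evb D) (row_a D \<xi> r) (ev D)"
    and B: "AAb D \<xi> r = cauchy (alphab D) (ev D) (row_ab D \<xi> r) (evb D)" for r
    by (simp_all add: AA_def AAb_def row_a_def row_ab_def EE_eq EEb_eq assms(1,2) cauchy_def
        vec_eq_iff mult_diag_entry vector_mult_diag_entry)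
  have p: "vderiv (row_ab D \<xi>) (1 *s (row_ab D \<xi> \<eta> v* diag (evb D))) \<eta>"
    and q: "vderiv (row_a D \<xi>) (- 1 *s (row_a D \<xi> \<eta> v* diag (ev D))) \<eta>"
    unfolding vderiv_def
    by (auto simp: row_a_def row_ab_def EE_eq EEb_eq assms(1,2) vector_mult_diag_entry
        intro!: derivative_eq_intros)
  have det: "det (mat 1 + AA D \<xi> \<eta> ** AAb D \<xi> \<eta>) \<noteq> 0"
    using assms(4) by (simp add: Omega_def)
  interpret I: cauchy_pair 1 \<eta> "ev D" "evb D" "alpha D" "alphab D" "row_ab D \<xi>" "row_a D \<xi>"
    using p q det assms(1-3) assms(3)[symmetric] by unfold_locales (simp_all add: A B)
  \<comment> \<open>Exchanging the roles reverses the sign of \<eta> in both exponents, hence the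
    sign \<open>- 1\<close>.\<close>
  interpret J: cauchy_pair "- 1" \<eta> "evb D" "ev D" "alphab D" "alpha D" "row_a D \<xi>" "row_ab D \<xi>"
    using p q det_one_plus_mult_swap[OF det] assms(1-3) by unfold_locales (simp_all add: A B)
  have AI: "I.A = AA D \<xi>" "I.B = AAb D \<xi>" "J.A = AAb D \<xi>" "J.B = AA D \<xi>"
    by (simp_all add: fun_eq_iff A B I.A_def I.B_def J.A_def J.B_def)
  have GI: "I.G = GG D \<xi>" "I.Gb = GGb D \<xi>" "J.G = GGb D \<xi>" "J.Gb = GG D \<xi>"
    by (simp_all add: fun_eq_iff AI GG_def GGb_def I.G_def I.Gb_def J.G_def J.Gb_def)
  have bI: "I.b = beta D" "I.d = betab D" "J.b = betab D" "J.d = beta D"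
    by (simp_all add: beta_def betab_def LL_def LLb_def I.b_def I.d_def J.b_def J.d_def)
  note defs = AI GI bI I.v_def I.w_def I.ub_def J.v_def J.w_def J.ub_def
  have fI: "I.v = v_fun D \<xi>" "I.w = w1 D \<xi>" "I.ub = ub_fun D \<xi>"
    and fJ: "J.v = vb_fun D \<xi>" "J.w = w2 D \<xi>" "J.ub = u_fun D \<xi>"
    by (simp_all add: fun_eq_iff defs v_fun_def w1_def ub_fun_def vb_fun_def w2_def u_fun_def)
  show ?thesis
    using I.u_deriv I.v_deriv I.w3_deriv J.u_deriv J.v_deriv J.w3_deriv
    by (simp add: fI fJ AI GI bI flip: row_b_def row_bb_def LL_def LLb_def u_fun_def ub_fun_def
        v_fun_def vb_fun_def w3_def w4_def)
qed

end
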